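(* Let $A=(a,b,c)$ be a triple of positive integers that is UM, and let $\kappa_A$ be the $A$-core that contains every other $A$-core as a subpartition. Let $p=\gcd(a,b)$, $q=\gcd(a,c)$, $r=\gcd(b,c)$, and let $d,e,f$ be integers such that $(a,b,c)=(dpq,\,epr,\,fqr)$ as ordered triples. If $f\in S(d,e)$, then a positive integer is in $\beta(\kappa_A)$ if and only if it is of the form $$(de+f)pqr-ia-jb-kc$$ for some positive integers $i$, $j$, and $k$.
   Context: A partition is a finite (possibly empty) nonincreasing sequence $\lambda=(\lambda_1,\dots,\lambda_r)$ of positive integers; $r$ is its length. A partition $\mu=(\mu_1,\dots,\mu_s)$ is a subpartition of $\lambda$ (written $\mu\subseteq\lambda$, and one says $\lambda$ contains $\mu$) if $s\le r$ and $\mu_i\le\lambda_i$ for all $1\le i\le s$. The Young diagram of $\lambda$ has $r$ left-justified rows, with $\lambda_i$ cells in row $i$. The hook length of a cell is the number of cells that are in the same row to its right, or in the same column below it, or equal to it. $\beta(\lambda)$ denotes the set of hook lengths in the leftmost column of the Young diagram of $\lambda$; equivalently $\beta(\lambda)=\{\lambda_1+r-1,\lambda_2+r-2,\dots,\lambda_r\}$. For a finite set $A$ of positive integers, an $A$-core is a partition no cell of whose Young diagram has hook length in $A$; $C(A)$ denotes the set of $A$-cores. The set $A$ is UM if there is an $A$-core $\kappa_A$ that contains every other $A$-core as a subpartition. A triple $(a,b,c)$ is treated as the set $\{a,b,c\}$ for these notions. $S(d,e)$ is the numerical semigroup generated by $d$ and $e$, i.e. the set of all linear combinations of $d$ and $e$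 with nonnegative integer coefficients. *)

theory Defs
  imports Main
begin

definition is_partition :: "nat list \<Rightarrow> bool" where
  "is_partition xs \<longleftrightarrow> sorted_wrt (\<ge>) xs \<and> (\<forall>x \<in> set xs. 0 < x)"

definition subpartition :: "nat list \<Rightarrow> nat list \<Rightarrow> bool" where
  "subpartition mu la \<longleftrightarrow>
     length mu \<le> length la \<and> (\<forall>i < length mu. mu ! i \<le> la ! i)"

(* Cells are pairs (row, column), both counted from 0. *)
definition young_diagram :: "nat list \<Rightarrow> (nat \<times> nat) set" where
  "young_diagram la = {(i, j). i < length la \<and> j < la ! i}"

definition hook_length :: "nat list \<Rightarrow> nat \<Rightarrow> nat \<Rightarrow> nat" where
  "hook_length la i j =
     card {(i', j') \<in> young_diagram la. (i' = i \<and> j \<le> j') \<or> (j' = j \<and> i \<le> i')}"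

definition beta_set :: "nat list \<Rightarrow> nat set" where
  "beta_set la = {hook_length la i 0 | i. (i, 0) \<in> young_diagram la}"

definition cores :: "nat set \<Rightarrow> nat list set" where
  "cores A = {la. is_partition la \<and>
     (\<forall>(i, j) \<in> young_diagram la. hook_length la i j \<notin> A)}"

definition is_max_core :: "nat set \<Rightarrow> nat list \<Rightarrow> bool" where
  "is_max_core A ka \<longleftrightarrow>
     ka \<in> cores A \<and> (\<forall>mu \<in> cores A. mu \<noteq> ka \<longrightarrow> subpartition mu ka)"

definition UM :: "nat set \<Rightarrow> bool" where
  "UM A \<longleftrightarrow> (\<exists>ka. is_max_core A ka)"

definition semigroup_gen :: "int \<Rightarrow> int \<Rightarrow> int set" where
  "semigroup_gen d e = {int x * d + int y * e | x y. True}"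

end

theory Submission
  imports Defs
begin

text \<open>A partition is an \<open>A\<close>-core iff its first-column hook lengths are closed under subtracting
elements of \<open>A\<close> as long as the result is nonnegative. Hence the first-column hook lengths of a core
avoid the numerical semigroup \<open>S\<close> generated by \<open>A\<close>. A maximal core has at least as many parts as any
core; this forces \<open>gcd(a,b,c) = 1\<close>, and then its first-column hook lengths are exactly the gaps
of \<open>S\<close>. Since \<open>p c\<close> is a nonnegative combination of \<open>a\<close> and \<open>b\<close>, every integer
is \<open>i a + j b + k c\<close> with \<open>0 \<le> j < d q\<close> and \<open>0 \<le> k < p\<close>, and it lies in \<open>S\<close> iff \<open>i \<ge> 0\<close>. With
\<open>F = (d e + f) p q r - a - b - c\<close> the map \<open>n \<mapsto> F - n\<close> replaces \<open>(i, j, k)\<close> by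
\<open>(-1 - i, d q - 1 - j, p - 1 - k)\<close>, so it exchanges \<open>S\<close> with its complement.\<close>

section \<open>Hook lengths and first-column hook lengths\<close>

lemma partition_antimono:
  assumes "is_partition la" "i \<le> k" "k < length la"
  shows "la ! k \<le> la ! i"
  using assms sorted_wrt_nth_less[of "(\<ge>)" la i k]
  by (cases "i = k") (auto simp: is_partition_def)

text \<open>Row lengths do not increase, so the rows that meet column \<open>j\<close> form an
  initial segment; \<open>m\<close> is the height of that column.\<close>

lemma column_height:
  assumes "is_partition la"
  obtains m where "\<And>k. k < length la \<and> j < la ! k \<longleftrightarrow> k < m"
proof -
  define m where "m = (LEAST k. \<not> (k < length la \<and> j < la ! k))"
  have "\<not> (m < length la \<and> j < la ! m)"
    unfolding m_def by (rule LeastI[of _ "length la"]) simp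
  then have "k < length la \<and> j < la ! k \<longleftrightarrow> k < m" for k
    using not_less_Least[of k "\<lambda>k. \<not> (k < length la \<and> j < la ! k)"]
      partition_antimono[OF assms, of m k]
    by (metis m_def leD le_less_trans less_le_trans not_le)
  then show thesis using that by blast
qed

text \<open>Arm and leg have \<open>la ! i - j - 1\<close> and \<open>m - i - 1\<close> cells; the
  additive form avoids truncated subtraction.\<close>

lemma hook_length_eq:
  assumes "\<And>k. k < length la \<and> j < la ! k \<longleftrightarrow> k < m" "i < m"
  shows "hook_length la i j + i + j + 1 = la ! i + m"
proof -
  have "{(i', j') \<in> young_diagram la. (i' = i \<and> j \<le> j') \<or> (j' = j \<and> i \<le> i')}
      = {i} \<times> {j..<la ! i} \<union> {Suc i..<m} \<times> {j}"
    using assms by (fastforce simp: young_diagram_def)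
  moreover have "card ({i} \<times> {j..<la ! i} \<union> {Suc i..<m} \<times> {j}) = (la ! i - j) + (m - Suc i)"
    by (subst card_Un_disjoint) (auto simp: card_cartesian_product)
  ultimately show ?thesis
    using assms(1)[of i] assms(2) by (auto simp: hook_length_def)
qed

lemma beta_set_eq:
  assumes "is_partition la"
  shows "beta_set la = (\<lambda>i. la ! i + (length la - 1 - i)) ` {..<length la}"
proof -
  have pos: "0 < la ! k" if "k < length la" for k
    using assms that by (auto simp: is_partition_def)
  have "hook_length la i 0 = la ! i + (length la - 1 - i)" if "i < length la" for i
    using hook_length_eq[of la 0 "length la" i] that pos by fastforce
  then show ?thesis
    using pos by (force simp: beta_set_def young_diagram_def)
qed

lemma beta_set_pos:
  assumes "is_partition la" "x \<in> beta_set la"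
  shows "0 < x"
proof -
  obtain i where "i < length la" "x = la ! i + (length la - 1 - i)"
    using assms by (auto simp: beta_set_eq)
  moreover from this have "0 < la ! i" using assms(1) by (simp add: is_partition_def)
  ultimately show ?thesis by linarith
qed

text \<open>The listed hook lengths strictly decrease from row to row, so counting parts amounts to
  counting first-column hooks.\<close>

lemma card_beta_set:
  assumes "is_partition la"
  shows "card (beta_set la) = length la"
proof -
  have "la ! k + (length la - 1 - k) < la ! i + (length la - 1 - i)"
    if "i < k" "k < length la" for i k
    using partition_antimono[OF assms, of i k] that by linarith
  then have "inj_on (\<lambda>i. la ! i + (length la - 1 - i)) {..<length la}"
    by (metis (lifting) inj_onI lessThan_iff linorder_neqE_nat nat_neq_iff)
  then show ?thesis
    unfolding beta_set_eq[OF assms] by (subst card_image) auto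
qed

lemma beta_set_Cons:
  assumes "is_partition (x # la)"
  shows "beta_set (x # la) = insert (x + length la) (beta_set la)"
proof -
  have "is_partition la" using assms by (simp add: is_partition_def)
  then show ?thesis
    by (simp add: beta_set_eq[OF assms] beta_set_eq[of la] lessThan_Suc_eq_insert_0 image_image)
qed

text \<open>Induction on the maximum: a new largest element \<open>m\<close> becomes the hook of a
  new first row, which must have length \<open>m - length la\<close>.\<close>

lemma ex_partition_beta_set:
  assumes "finite X" "\<And>x. x \<in> X \<Longrightarrow> 0 < x"
  shows "\<exists>la. is_partition la \<and> beta_set la = X"
  using assms
proof (induction X rule: finite_linorder_max_induct)
  case empty
  have "is_partition [] \<and> beta_set [] = {}"
    by (auto simp: is_partition_def beta_set_def young_diagram_def)
  then show ?case by blast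
next
  case (insert m X)
  then obtain la where la: "is_partition la" "beta_set la = X" by auto
  have X: "X \<subseteq> {1..<m}" using insert by (fastforce simp: Suc_le_eq)
  have "length la < m"
    using card_mono[OF finite_atLeastLessThan X] card_beta_set[OF la(1)] la(2) insert.prems[of m]
    by simp
  \<comment> \<open>The new row is at least as long as the old first row, because the hook length of
    the latter lies in \<open>X\<close> and hence below \<open>m\<close>.\<close>
  moreover have "x \<le> m - length la" if "x \<in> set la" for x
  proof -
    obtain i where i: "i < length la" "x = la ! i" using \<open>x \<in> set la\<close> by (auto simp: in_set_conv_nth)
    then have "x \<le> la ! 0" using partition_antimono[OF la(1), of 0 i] by simp
    moreover have "la ! 0 + (length la - 1 - 0) \<in> X"
      unfolding la(2)[symmetric] beta_set_eq[OF la(1)] using i by (intro imageI) auto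
    then have "la ! 0 + (length la - 1) < m" using insert.hyps by auto
    ultimately show ?thesis using i by linarith
  qed
  ultimately have "is_partition ((m - length la) # la)"
    using la(1) by (auto simp: is_partition_def)
  moreover have "beta_set ((m - length la) # la) = insert m X"
    using beta_set_Cons[OF calculation] la \<open>length la < m\<close> by simp
  ultimately show ?case by blast
qed

text \<open>Take \<open>x\<close> to be the first-column hook of row \<open>i\<close>. Subtracting
  the hook length leaves \<open>length la + j - m\<close>, with \<open>m\<close> the height of
  column \<open>j\<close>; rows above \<open>m\<close> have larger first-column hooks, rows from
  \<open>m\<close> on smaller ones.\<close>

lemma hook_length_eq_diff:
  assumes la: "is_partition la" and ij: "(i, j) \<in> young_diagram la"
  shows "\<exists>x \<in> beta_set la. hook_length la i j \<le> x \<and> x - hook_length la i j \<notin> beta_set la"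
proof -
  obtain m where m: "\<And>k. k < length la \<and> j < la ! k \<longleftrightarrow> k < m"
    using column_height[OF la] by blast
  have i: "i < length la" "j < la ! i" "i < m"
    using ij m[of i] by (auto simp: young_diagram_def)
  have h: "hook_length la i j + i + j + 1 = la ! i + m"
    using hook_length_eq[of la j m, OF m i(3)] .
  have "m \<le> length la" using m[of "length la"] by auto
  define x where "x = la ! i + (length la - 1 - i)"
  have "x \<in> beta_set la" using i by (auto simp: beta_set_eq[OF la] x_def)
  moreover have y: "x = hook_length la i j + (length la + j - m)"
    using h i \<open>m \<le> length la\<close> by (simp add: x_def)
  moreover have "length la + j - m \<noteq> la ! k + (length la - 1 - k)" if "k < length la" for k
    using m[of k] that \<open>m \<le> length la\<close> by (cases "k < m") auto
  then have "length la + j - m \<notin> beta_set la"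
    by (auto simp: beta_set_eq[OF la])
  ultimately show ?thesis by (intro bexI[of _ x]) auto
qed

lemma ex_hook_length_diff:
  assumes la: "is_partition la" and x: "x \<in> beta_set la" and y: "y < x" "y \<notin> beta_set la"
  shows "\<exists>(i, j) \<in> young_diagram la. hook_length la i j = x - y"
proof -
  let ?r = "length la"
  let ?b = "\<lambda>k. la ! k + (?r - 1 - k)"
  obtain i where i: "i < ?r" "x = ?b i"
    using x by (auto simp: beta_set_eq[OF la])
  \<comment> \<open>The number of first-column hooks exceeding \<open>y\<close>; it will be the
    height of the column sought.\<close>
  define m where "m = (LEAST k. \<not> (k < ?r \<and> y < ?b k))"
  have m0: "\<not> (m < ?r \<and> y < ?b m)"
    unfolding m_def by (rule LeastI[of _ ?r]) simp
  have below: "k < ?r \<and> y < ?b k" if "k < m" for k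
    using not_less_Least[of k "\<lambda>k. \<not> (k < ?r \<and> y < ?b k)"] that by (auto simp: m_def)
  have m_le: "m \<le> ?r" using below by (meson less_irrefl not_le)
  have above: "?b k < y" if "m \<le> k" "k < ?r" for k
  proof -
    have "?b m \<noteq> y" using y(2) that by (auto simp: beta_set_eq[OF la])
    moreover have "?b k \<le> ?b m"
      using partition_antimono[OF la that] that by linarith
    ultimately show ?thesis using m0 that by linarith
  qed
  have "i < m" using above[of i] i y by (meson not_le less_asym)
  have "?r \<le> y + m"
  proof (cases "m < ?r")
    case True
    then show ?thesis using above[of m] by linarith
  qed simp
  \<comment> \<open>Solves \<open>y = length la + j - m\<close>, the value left over in the converse
    direction; the preceding inequality keeps the subtraction exact.\<close>
  define j where "j = y + m - ?r"
  have row: "k < ?r \<and> j < la ! k \<longleftrightarrow> k < m" for k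
  proof
    assume k: "k < m"
    then have "la ! (m - 1) \<le> la ! k" using partition_antimono[OF la, of k "m - 1"] m_le by simp
    moreover have "y < ?b (m - 1)" using below[of "m - 1"] k by simp
    ultimately show "k < ?r \<and> j < la ! k" using k m_le \<open>?r \<le> y + m\<close> by (simp add: j_def)
  next
    assume k: "k < ?r \<and> j < la ! k"
    show "k < m"
    proof (rule ccontr)
      assume "\<not> k < m"
      then have "la ! k \<le> la ! m" "m < ?r" using partition_antimono[OF la, of m k] k by auto
      moreover from this have "?b m < y" using above by simp
      ultimately show False using k unfolding j_def by linarith
    qed
  qed
  have "hook_length la i j = x - y"
    using hook_length_eq[of la j m i, OF row \<open>i < m\<close>] i \<open>?r \<le> y + m\<close> y(1) by (simp add: j_def)
  moreover have "(i, j) \<in> young_diagram la"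
    using row[of i] \<open>i < m\<close> by (simp add: young_diagram_def)
  ultimately show ?thesis by blast
qed

text \<open>Hook lengths are exactly the differences \<open>x - y\<close> with \<open>x\<close> in
  the beta set and \<open>y < x\<close> outside it. The case \<open>t = x\<close> forbids
  \<open>x\<close> itself, as 0 is never in the beta set.\<close>

lemma cores_iff_beta_closed:
  assumes "is_partition la"
  shows "la \<in> cores A \<longleftrightarrow> (\<forall>x \<in> beta_set la. \<forall>t \<in> A. t \<le> x \<longrightarrow> x - t \<in> beta_set la)"
    (is "_ \<longleftrightarrow> ?closed")
proof
  assume core: "la \<in> cores A"
  show ?closed
  proof (intro ballI impI, rule ccontr)
    fix x t assume *: "x \<in> beta_set la" "t \<in> A" "t \<le> x" "x - t \<notin> beta_set la"
    then have "x - t < x" by (metis diff_less_Suc diff_le_self le_neq_implies_less)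
    with ex_hook_length_diff[OF assms *(1) _ *(4)] * core show False
      by (auto simp: cores_def)
  qed
next
  assume ?closed
  then show "la \<in> cores A"
    using hook_length_eq_diff[OF assms] assms by (fastforce simp: cores_def)
qed

section \<open>The maximal core\<close>

text \<open>Such an \<open>X\<close> is the beta set of a core with \<open>card X\<close> parts, and
  containment in \<open>ka\<close> bounds the number of parts.\<close>

lemma card_le_length_max_core:
  assumes "is_max_core A ka" "finite X" "\<And>x. x \<in> X \<Longrightarrow> 0 < x"
    and "\<And>x t. x \<in> X \<Longrightarrow> t \<in> A \<Longrightarrow> t \<le> x \<Longrightarrow> x - t \<in> X"
  shows "card X \<le> length ka"
proof -
  obtain la where la: "is_partition la" "beta_set la = X"
    using ex_partition_beta_set[OF assms(2,3)] by blast
  then have "la \<in> cores A" using cores_iff_beta_closed assms(4) by blast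
  then have "length la \<le> length ka"
    using assms(1) by (cases "la = ka") (auto simp: is_max_core_def subpartition_def)
  then show ?thesis using card_beta_set la by metis
qed

lemma max_core_coprime:
  assumes "is_max_core A ka" "\<And>t. t \<in> A \<Longrightarrow> g dvd t" "g \<noteq> 0"
  shows "g = 1"
proof (rule ccontr)
  assume "g \<noteq> 1"
  \<comment> \<open>Elements of \<open>A\<close> are multiples of \<open>g\<close>, so subtracting
    them stays in the class of 1 modulo \<open>g\<close>, which misses 0 when
    \<open>g \<noteq> 1\<close>. The set has \<open>length ka + 1\<close> elements, one too
    many.\<close>
  let ?X = "(\<lambda>k. 1 + k * g) ` {..length ka}"
  have "card ?X \<le> length ka"
  proof (rule card_le_length_max_core[OF assms(1)])
    fix x t assume x: "x \<in> ?X" and "t \<in> A" "t \<le> x"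
    then obtain k where k: "x = 1 + k * g" "k \<le> length ka" by blast
    obtain s where s: "t = s * g" using assms(2)[OF \<open>t \<in> A\<close>] by (metis dvdE mult.commute)
    have "s \<le> k"
    proof (rule ccontr)
      assume "\<not> s \<le> k"
      then have "(k + 1) * g \<le> s * g" by (intro mult_right_mono) auto
      then show False using k s \<open>t \<le> x\<close> \<open>g \<noteq> 1\<close> \<open>g \<noteq> 0\<close> by (simp add: algebra_simps)
    qed
    then have "x - t = 1 + (k - s) * g"
      using k s by (simp add: diff_mult_distrib Suc_diff_le)
    then show "x - t \<in> ?X" using k by (intro image_eqI[of _ _ "k - s"]) auto
  qed auto
  moreover have "inj_on (\<lambda>k. 1 + k * g) {..length ka}"
    using \<open>g \<noteq> 0\<close> by (auto simp: inj_on_def)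
  ultimately show False by (simp add: card_image)
qed

section \<open>The gaps of the semigroup and the maximal core\<close>

definition semigroup3 :: "nat \<Rightarrow> nat \<Rightarrow> nat \<Rightarrow> nat set" where
  "semigroup3 a b c = {i * a + j * b + k * c | i j k. True}"

lemma semigroup3_add:
  assumes "n \<in> semigroup3 a b c" "t \<in> {a, b, c}"
  shows "n + t \<in> semigroup3 a b c"
proof -
  obtain i j k where "n = i * a + j * b + k * c"
    using assms(1) by (auto simp: semigroup3_def)
  then have "n + a = Suc i * a + j * b + k * c" "n + b = i * a + Suc j * b + k * c"
    "n + c = i * a + j * b + Suc k * c"
    by simp_all
  then show ?thesis using assms(2) unfolding semigroup3_def by blast
qed

text \<open>From a common element, closure would allow subtracting generators one at a time down to
  0, which is no hook length.\<close>

lemma core_beta_disjoint_semigroup3: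
  assumes "ka \<in> cores {a, b, c}"
  shows "beta_set ka \<inter> semigroup3 a b c = {}"
proof -
  have la: "is_partition ka" using assms by (simp add: cores_def)
  have step: "x + t \<in> beta_set ka \<Longrightarrow> x \<in> beta_set ka" if "t \<in> {a, b, c}" for x t
    using assms that cores_iff_beta_closed[OF la, of "{a, b, c}"] by fastforce
  have mult: "x + i * t \<in> beta_set ka \<Longrightarrow> x \<in> beta_set ka" if "t \<in> {a, b, c}" for x i t
    by (induction i) (use step[OF that] in \<open>auto simp: algebra_simps\<close>)
  have "0 + i * a + j * b + k * c \<notin> beta_set ka" for i j k
    using mult[of a 0 i] mult[of b "0 + i * a" j] mult[of c "0 + i * a + j * b" k]
      beta_set_pos[OF la, of 0] by blast
  then show ?thesis by (auto simp: semigroup3_def)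
qed

text \<open>The gaps are closed under subtracting generators, so there are at most
  \<open>length ka\<close> of them; \<open>beta_set ka\<close> is a set of gaps with exactly that
  many elements.\<close>

lemma max_core_beta_set:
  assumes "is_max_core {a, b, c} ka" "finite (- semigroup3 a b c)"
  shows "beta_set ka = - semigroup3 a b c"
proof (rule card_subset_eq[OF assms(2)])
  have core: "ka \<in> cores {a, b, c}" using assms(1) by (simp add: is_max_core_def)
  show sub: "beta_set ka \<subseteq> - semigroup3 a b c"
    using core_beta_disjoint_semigroup3[OF core] by blast
  have "0 \<in> semigroup3 a b c" by (auto simp: semigroup3_def)
  then have "card (- semigroup3 a b c) \<le> length ka"
  proof (intro card_le_length_max_core[OF assms])
    fix x t assume "x \<in> - semigroup3 a b c" "t \<in> {a, b, c}" "t \<le> x"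
    then show "x - t \<in> - semigroup3 a b c"
      using semigroup3_add[of "x - t" a b c t] by auto
  qed (auto intro: gr0I)
  then show "card (beta_set ka) = card (- semigroup3 a b c)"
    using card_beta_set[of ka] core card_mono[OF assms(2) sub] by (simp add: cores_def)
qed

section \<open>Symmetry of the semigroup\<close>

text \<open>Bezout for \<open>c\<close>, \<open>p\<close> and then for \<open>u\<close>,
  \<open>v\<close>: reduce the coefficient of \<open>c\<close> modulo \<open>p\<close>, then that of
  \<open>v * p\<close> modulo \<open>u\<close>, and let the quotients be absorbed by the other
  terms.\<close>

lemma canonical_representation:
  fixes c n p u v :: int
  assumes "0 < p" "0 < u" "coprime c p" "coprime u v"
  obtains i j k where "n = i * (u * p) + j * (v * p) + k * c" "0 \<le> j" "j < u" "0 \<le> k" "k < p"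
proof -
  obtain s t where st: "s * c + t * p = 1"
    using bezout_int[of c p] assms(3) by auto
  obtain s' t' where st': "s' * u + t' * v = 1"
    using bezout_int[of u v] assms(4) by auto
  define k where "k = (n * s) mod p"
  define m where "m = (n * s) div p * c + n * t"
  define j where "j = (m * t') mod u"
  have "n = n * s * c + n * t * p"
    using arg_cong[OF st, of "\<lambda>z. n * z"] by (simp add: algebra_simps)
  also have "n * s = (n * s) div p * p + k" by (simp add: k_def)
  finally have n: "n = m * p + k * c" by (simp add: m_def algebra_simps)
  have "m = m * s' * u + m * t' * v"
    using arg_cong[OF st', of "\<lambda>z. m * z"] by (simp add: algebra_simps)
  also have "m * t' = (m * t') div u * u + j" by (simp add: j_def)
  finally have m: "m = (m * s' + (m * t') div u * v) * u + j * v" by (simp add: algebra_simps)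
  have "n = (m * s' + (m * t') div u * v) * (u * p) + j * (v * p) + k * c"
    using n arg_cong[OF m, of "\<lambda>z. z * p"] by (simp add: algebra_simps)
  then show thesis
    by (rule that) (use assms in \<open>auto simp: j_def k_def\<close>)
qed

text \<open>Coprimality forces \<open>k = p * l\<close> with \<open>l \<ge> 1\<close>. After
  division by \<open>p\<close>, one \<open>c\<close> cancels and the other \<open>l - 1\<close>
  copies are spread over \<open>u\<close> and \<open>v\<close>, which reduces the claim to
  \<open>u * v\<close> not being a positive combination of coprime \<open>u\<close> and
  \<open>v\<close>.\<close>

lemma frobenius_not_representable:
  fixes c p u v i j k x y :: int
  assumes "0 < p" "0 < u" "0 < v" "coprime c p" "coprime u v"
    and c: "c = x * u + y * v" "0 \<le> x" "0 \<le> y"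
    and pos: "0 < i" "0 < j" "0 < k"
  shows "u * v * p + p * c \<noteq> i * (u * p) + j * (v * p) + k * c"
proof
  assume eq: "u * v * p + p * c = i * (u * p) + j * (v * p) + k * c"
  then have "k * c = p * (u * v + c - i * u - j * v)" by (simp add: algebra_simps)
  then have "p dvd k" using \<open>coprime c p\<close>
    by (metis coprime_commute coprime_dvd_mult_left_iff dvd_triv_left)
  then obtain l where l: "k = p * l" ..
  have "0 < l" using pos l assms(1) by (simp add: zero_less_mult_iff)
  have "p * (u * v + c) = p * (i * u + j * v + l * c)"
    using eq l by (simp add: algebra_simps)
  then have "u * v + c = i * u + j * v + l * c" using assms(1) by simp
  then have uv: "u * v = (i + (l - 1) * x) * u + (j + (l - 1) * y) * v"
    by (simp add: c algebra_simps)
  define I J where "I = i + (l - 1) * x" and "J = j + (l - 1) * y"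
  have IJ: "0 < I" "0 < J"
    using pos c \<open>0 < l\<close> by (auto simp: I_def J_def intro!: add_pos_nonneg)
  have uv: "u * v = I * u + J * v" using uv by (simp add: I_def J_def)
  then have "J * v = u * (v - I)" by (simp add: algebra_simps)
  then have "u dvd J" using \<open>coprime u v\<close>
    by (metis coprime_dvd_mult_left_iff dvd_triv_left)
  then have "u \<le> J" using IJ by (simp add: zdvd_imp_le)
  then have "u * v \<le> J * v" using assms(3) by simp
  moreover have "0 < I * u" using IJ assms(2) by simp
  ultimately show False using uv by linarith
qed

lemma int_in_semigroup3_iff:
  "n \<in> semigroup3 a b c \<longleftrightarrow>
    (\<exists>i j k. 0 \<le> i \<and> 0 \<le> j \<and> 0 \<le> k \<and> int n = i * int a + j * int b + k * int c)"
proof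
  assume "n \<in> semigroup3 a b c"
  then obtain i j k where "n = i * a + j * b + k * c" by (auto simp: semigroup3_def)
  then show "\<exists>i j k. 0 \<le> i \<and> 0 \<le> j \<and> 0 \<le> k \<and> int n = i * int a + j * int b + k * int c"
    by (intro exI[of _ "int i"] exI[of _ "int j"] exI[of _ "int k"]) simp
next
  assume "\<exists>i j k. 0 \<le> i \<and> 0 \<le> j \<and> 0 \<le> k \<and> int n = i * int a + j * int b + k * int c"
  then obtain i j k where "0 \<le> i" "0 \<le> j" "0 \<le> k" "int n = i * int a + j * int b + k * int c"
    by blast
  then have "int n = int (nat i * a + nat j * b + nat k * c)" by simp
  then have "n = nat i * a + nat j * b + nat k * c" by (simp only: of_nat_eq_iff)
  then show "n \<in> semigroup3 a b c" unfolding semigroup3_def by blast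
qed

lemma gap_iff:
  fixes p u v x y :: int
  assumes pos: "0 < p" "0 < u" "0 < v" and cop: "coprime (int c) p" "coprime u v"
    and ab: "int a = u * p" "int b = v * p" and c: "int c = x * u + y * v" "0 \<le> x" "0 \<le> y"
  shows "n \<notin> semigroup3 a b c \<longleftrightarrow>
    (\<exists>i j k. 0 < i \<and> 0 < j \<and> 0 < k \<and>
      int n = u * v * p + p * int c - i * int a - j * int b - k * int c)"
    (is "_ \<longleftrightarrow> ?R")
proof
  assume gap: "n \<notin> semigroup3 a b c"
  obtain i j k where n: "int n = i * (u * p) + j * (v * p) + k * int c"
    and jk: "0 \<le> j" "j < u" "0 \<le> k" "k < p"
    using canonical_representation[OF pos(1,2) cop] .
  have "i < 0" using gap n jk unfolding int_in_semigroup3_iff ab by (meson not_le)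
  \<comment> \<open>The terms \<open>u * int b = u * v * p\<close> and \<open>p * int c\<close>
    cancel.\<close>
  moreover have "int n = u * v * p + p * int c - (- i) * int a - (u - j) * int b - (p - k) * int c"
    using n by (simp add: ab algebra_simps)
  ultimately show ?R using jk
    by (intro exI[of _ "- i"] exI[of _ "u - j"] exI[of _ "p - k"]) simp
next
  assume ?R
  then obtain i j k where ijk: "0 < i" "0 < j" "0 < k"
    and n: "int n = u * v * p + p * int c - i * int a - j * int b - k * int c" by blast
  show "n \<notin> semigroup3 a b c"
  proof
    assume "n \<in> semigroup3 a b c"
    then obtain i' j' k' where "0 \<le> i'" "0 \<le> j'" "0 \<le> k'"
      and n': "int n = i' * int a + j' * int b + k' * int c"
      unfolding int_in_semigroup3_iff by blast
    \<comment> \<open>Adding the two representations keeps all coefficients positive, which is the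
      excluded situation.\<close>
    then have "u * v * p + p * int c \<noteq> (i + i') * (u * p) + (j + j') * (v * p) + (k + k') * int c"
      using ijk by (intro frobenius_not_representable[OF pos cop c]) auto
    then show False using n n' by (simp add: ab algebra_simps)
  qed
qed

lemma ex_pos_int_iff: "(\<exists>i>0::int. P i) \<longleftrightarrow> (\<exists>i>0::nat. P (int i))"
  by (metis of_nat_0_less_iff zero_less_imp_eq_int)

theorem theorem1p5:
  fixes a b c p q r :: nat and d e f :: int and kappa :: "nat list"
  assumes "0 < a" and "0 < b" and "0 < c"
    and "UM {a, b, c}"
    and "is_max_core {a, b, c} kappa"
    and "p = gcd a b" and "q = gcd a c" and "r = gcd b c"
    and "int a = d * int p * int q"
    and "int b = e * int p * int r"
    and "int c = f * int q * int r"
    and "f \<in> semigroup_gen d e"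
  shows "\<forall>n::nat. 0 < n \<longrightarrow>
    (n \<in> beta_set kappa \<longleftrightarrow>
      (\<exists>i j k :: nat. 0 < i \<and> 0 < j \<and> 0 < k \<and>
        int n = (d * e + f) * int p * int q * int r
                  - int i * int a - int j * int b - int k * int c))"
proof -
  obtain x y :: nat where f: "f = int x * d + int y * e"
    using assms(12) by (auto simp: semigroup_gen_def)
  have p0: "0 < p" "0 < q" "0 < r" using assms(1-3,6-8) by auto
  \<comment> \<open>These are \<open>a / p\<close> and \<open>b / p\<close>; their positivity comes
    from that of \<open>a\<close> and \<open>b\<close>.\<close>
  define u v where "u = d * int q" and "v = e * int r"
  have ab: "int a = u * int p" "int b = v * int p" using assms(9,10) by (simp_all add: u_def v_def)
  have uv: "0 < u" "0 < v" using ab assms(1,2) p0(1)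
    by (metis of_nat_0_less_iff zero_less_mult_pos2)+
  have "int p * gcd u v = gcd (int a) (int b)"
    by (simp add: ab gcd_mult_distrib_int[symmetric] mult.commute[of _ "int p"] abs_mult)
  then have "int p * gcd u v = int p * 1" using assms(6) by simp
  then have cop_uv: "coprime u v" using p0(1) by (simp add: coprime_iff_gcd_eq_1)
  \<comment> \<open>As \<open>p = gcd a b\<close>, this is the gcd of the whole triple.\<close>
  have "gcd c p = 1"
    by (rule max_core_coprime[OF assms(5)]) (use assms(3,6) in \<open>auto intro: dvd_trans[OF gcd_dvd2]\<close>)
  then have cop_cp: "coprime (int c) (int p)"
    by (simp add: coprime_iff_gcd_eq_1 del: coprime_int_iff)
  \<comment> \<open>Here \<open>f \<in> semigroup_gen d e\<close> enters, multiplied by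
    \<open>q * r\<close>.\<close>
  have c: "int c = int (x * r) * u + int (y * q) * v"
    using assms(11) by (simp add: f u_def v_def algebra_simps)
  have frob: "u * v * int p + int p * int c = (d * e + f) * int p * int q * int r"
    using assms(11) by (simp add: u_def v_def algebra_simps)
  have gap: "n \<notin> semigroup3 a b c \<longleftrightarrow>
      (\<exists>i>0. \<exists>j>0. \<exists>k>0. int n = (d * e + f) * int p * int q * int r
                  - i * int a - j * int b - k * int c)" for n
    using gap_iff[of "int p" u v c a b "int (x * r)" "int (y * q)" n] p0 uv cop_uv cop_cp ab c
    unfolding frob by auto
  \<comment> \<open>The formula for the gaps bounds them, which gives the finiteness needed to
    identify them with the beta set.\<close>
  have "- semigroup3 a b c \<subseteq> {..nat ((d * e + f) * int p * int q * int r)}"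
  proof
    fix n assume "n \<in> - semigroup3 a b c"
    then obtain i j k where "0 < i" "0 < j" "0 < k" and
      n: "int n = (d * e + f) * int p * int q * int r - i * int a - j * int b - k * int c"
      using gap by auto
    then have "0 \<le> i * int a" "0 \<le> j * int b" "0 \<le> k * int c" by simp_all
    then show "n \<in> {..nat ((d * e + f) * int p * int q * int r)}"
      using n by (simp add: le_nat_iff)
  qed
  then have "beta_set kappa = - semigroup3 a b c"
    using max_core_beta_set[OF assms(5)] finite_subset by blast
  then have "n \<in> beta_set kappa \<longleftrightarrow>
      (\<exists>i>0. \<exists>j>0. \<exists>k>0. int n = (d * e + f) * int p * int q * int r
                  - int i * int a - int j * int b - int k * int c)" for n
    using gap[of n] by (simp only: Compl_iff ex_pos_int_iff)
  then show ?thesis by blast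
qed

end
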